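(* Consider the channel creation game with $N>3$ nodes $1,\dots,N$, blockchain fee $F_B>0$, constant forwarding fee $f_0\ge 0$, and the homogeneous payment scenario with $k\ge 1$ payments from every node to every other node. Consider the clique strategy combination: for each $i$, node $i$ opens exactly $N-i$ channels, one to each of the nodes $i+1,\dots,N$. If $$f_0>\frac{F_B}{k},$$ then the clique strategy combination is a Nash equilibrium.
   Context: Channel creation game. The players are the $N$ nodes. Fixed parameters: a blockchain fee $F_B\in\mathbb{R}$, $F_B>0$, a forwarding fee $f_0\ge 0$ that is the same for all nodes, and a payment scenario (a finite multiset of transactions, each with a sender and a different receiver). In the homogeneous payment scenario, for every ordered pair $(s,r)$ of distinct nodes there are exactly $k$ transactions from $s$ to $r$. Strategies: simultaneously and with full information, each node $u$ chooses a set $\mu_u$ of other nodes to which it opens channels; it pays $F_B$ for each channel it opens. Channels are usable in both directions by everyone and have unlimited capital. The strategy combination determines an undirected graph with an edge $\{u,v\}$ whenever $u$ opens a channel to $v$ or $v$ to $u$. Transactions: a route of a transaction is a path in this graph from sender to receiver; a route with $\ell$ edges costs the sender $(\ell-1)f_0$, and each of its $\ell-1$ intermediate nodes receives $f_0$. If the cheapest route costs less than $F_B$, the transaction is executed along a cheapest (shortest) route; if there are several, one is chosen uniformly at random and costs and revenues are taken in expectation. Otherwise (no route of cost less than $F_B$) the transaction is executed on-chain and the sender pays $F_B$. The cost of node $u$ is $|\mu_u|F_B$, plus the fees $u$ pays as sender (off-chain routing fees, and $F_B$ per on-chain transaction), minus the (expected) forwarding revenue of $u$. Each node wants to minimize its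 cost. A (pure) Nash equilibrium is a strategy combination in which no node can strictly decrease its cost by unilaterally changing its strategy. *)

theory Defs
  imports "HOL-Probability.Probability" "Graph_Theory.Graph_Theory"
begin

text \<open>
  The payments form a finite multiset of (sender, receiver) pairs. A strategy profile \<open>\<mu>\<close>
  maps each node to the set of nodes to which it opens channels; its values outside of
  \<open>nodes\<close> are irrelevant.
\<close>

locale channel_game =
  fixes nodes :: "'a set"
    and F\<^sub>B f\<^sub>0 :: real
    and payments :: "('a \<times> 'a) multiset"
  assumes finite_nodes: "finite nodes"
    and F\<^sub>B_pos: "F\<^sub>B > 0"
    and f\<^sub>0_nonneg: "f\<^sub>0 \<ge> 0"
    and payments_wf: "\<And>s r. (s, r) \<in># payments \<Longrightarrow> s \<in> nodes \<and> r \<in> nodes \<and> s \<noteq> r"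
begin

definition strategies :: "'a \<Rightarrow> 'a set set" where
  "strategies u = Pow (nodes - {u})"

definition valid_profile :: "('a \<Rightarrow> 'a set) \<Rightarrow> bool" where
  "valid_profile \<mu> \<longleftrightarrow> (\<forall>u\<in>nodes. \<mu> u \<in> strategies u)"

text \<open>
  An undirected edge is represented by its two orientations, as in the locale \<open>pair_graph\<close>.
\<close>
definition channel_graph :: "('a \<Rightarrow> 'a set) \<Rightarrow> 'a pair_pre_digraph" where
  "channel_graph \<mu> =
     \<lparr> pverts = nodes, parcs = {(u, v). u \<in> nodes \<and> v \<in> nodes \<and> (v \<in> \<mu> u \<or> u \<in> \<mu> v)} \<rparr>"

text \<open>A route is the list of the edges of a simple path, so its length is the number of edges.\<close>
definition routes :: "('a \<Rightarrow> 'a set) \<Rightarrow> 'a \<Rightarrow> 'a \<Rightarrow> ('a \<times> 'a) awalk set" where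
  "routes \<mu> s r = {p. pre_digraph.apath (with_proj (channel_graph \<mu>)) s p r}"

definition route_cost :: "('a \<times> 'a) awalk \<Rightarrow> real" where
  "route_cost p = (real (length p) - 1) * f\<^sub>0"

definition cheapest_routes :: "('a \<Rightarrow> 'a set) \<Rightarrow> 'a \<Rightarrow> 'a \<Rightarrow> ('a \<times> 'a) awalk set" where
  "cheapest_routes \<mu> s r =
     {p \<in> routes \<mu> s r. \<forall>q \<in> routes \<mu> s r. route_cost p \<le> route_cost q}"

definition off_chain :: "('a \<Rightarrow> 'a set) \<Rightarrow> 'a \<Rightarrow> 'a \<Rightarrow> bool" where
  "off_chain \<mu> s r \<longleftrightarrow> (\<exists>p \<in> cheapest_routes \<mu> s r. route_cost p < F\<^sub>B)"

definition route_pmf :: "('a \<Rightarrow> 'a set) \<Rightarrow> 'a \<Rightarrow> 'a \<Rightarrow> ('a \<times> 'a) awalk pmf" where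
  "route_pmf \<mu> s r = pmf_of_set (cheapest_routes \<mu> s r)"

definition intermediates :: "'a \<Rightarrow> 'a \<Rightarrow> ('a \<times> 'a) awalk \<Rightarrow> 'a set" where
  "intermediates s r p = set (pawalk_verts s p) - {s, r}"

definition sender_fee :: "('a \<Rightarrow> 'a set) \<Rightarrow> 'a \<Rightarrow> 'a \<Rightarrow> real" where
  "sender_fee \<mu> s r =
     (if off_chain \<mu> s r then measure_pmf.expectation (route_pmf \<mu> s r) route_cost else F\<^sub>B)"

definition forwarding_revenue :: "('a \<Rightarrow> 'a set) \<Rightarrow> 'a \<Rightarrow> 'a \<Rightarrow> 'a \<Rightarrow> real" where
  "forwarding_revenue \<mu> u s r =
     (if off_chain \<mu> s r
      then measure_pmf.expectation (route_pmf \<mu> s r)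
             (\<lambda>p. if u \<in> intermediates s r p then f\<^sub>0 else 0)
      else 0)"

definition cost :: "('a \<Rightarrow> 'a set) \<Rightarrow> 'a \<Rightarrow> real" where
  "cost \<mu> u =
     real (card (\<mu> u)) * F\<^sub>B
     + (\<Sum>(s, r) \<in># filter_mset (\<lambda>t. fst t = u) payments. sender_fee \<mu> s r)
     - (\<Sum>(s, r) \<in># payments. forwarding_revenue \<mu> u s r)"

definition nash_equilibrium :: "('a \<Rightarrow> 'a set) \<Rightarrow> bool" where
  "nash_equilibrium \<mu> \<longleftrightarrow>
     valid_profile \<mu> \<and>
     (\<forall>u\<in>nodes. \<not> (\<exists>S\<in>strategies u. cost (\<mu>(u := S)) u < cost \<mu> u))"

lemma pair_graph_channel_graph:
  assumes "valid_profile \<mu>"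
  shows "pair_graph (channel_graph \<mu>)"
proof
  have *: "parcs (channel_graph \<mu>) \<subseteq> nodes \<times> nodes" "pverts (channel_graph \<mu>) = nodes"
    by (auto simp: channel_graph_def)
  show "finite (pverts (channel_graph \<mu>))" "finite (parcs (channel_graph \<mu>))"
    using * finite_nodes by (auto intro: finite_subset)
  show "fst e \<in> pverts (channel_graph \<mu>)" "snd e \<in> pverts (channel_graph \<mu>)"
    "fst e \<noteq> snd e" if "e \<in> parcs (channel_graph \<mu>)" for e
    using that assms
    by (cases e; fastforce simp: channel_graph_def valid_profile_def strategies_def)+
  show "symmetric (with_proj (channel_graph \<mu>))"
    by (auto simp: channel_graph_def symmetric_def intro: symI)
qed

lemma finite_routes:
  assumes "valid_profile \<mu>"
  shows "finite (routes \<mu> s r)"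
proof -
  interpret pair_graph "channel_graph \<mu>" by (rule pair_graph_channel_graph[OF assms])
  show ?thesis unfolding routes_def by (rule apaths_finite)
qed

lemma finite_cheapest_routes:
  assumes "valid_profile \<mu>"
  shows "finite (cheapest_routes \<mu> s r)"
  using finite_routes[OF assms] by (simp add: cheapest_routes_def)

lemma cheapest_routes_nonempty:
  assumes "valid_profile \<mu>" "routes \<mu> s r \<noteq> {}"
  shows "cheapest_routes \<mu> s r \<noteq> {}"
  using ex_is_arg_min_if_finite[OF finite_routes[OF assms(1)] assms(2), of route_cost]
  by (force simp: cheapest_routes_def is_arg_min_def not_less)

end

definition homogeneous_payments :: "'a set \<Rightarrow> nat \<Rightarrow> ('a \<times> 'a) multiset" where
  "homogeneous_payments V k = repeat_mset k (mset_set {(s, r). s \<in> V \<and> r \<in> V \<and> s \<noteq> r})"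

lemma count_homogeneous_payments:
  assumes "finite V"
  shows "count (homogeneous_payments V k) (s, r) = (if s \<in> V \<and> r \<in> V \<and> s \<noteq> r then k else 0)"
proof -
  have "finite {(s, r). s \<in> V \<and> r \<in> V \<and> s \<noteq> r}"
    by (rule finite_subset[of _ "V \<times> V"]) (use assms in auto)
  then show ?thesis
    by (simp add: homogeneous_payments_def count_mset_set')
qed

lemma channel_game_homogeneous:
  assumes "finite V" "F\<^sub>B > 0" "f\<^sub>0 \<ge> 0"
  shows "channel_game V F\<^sub>B f\<^sub>0 (homogeneous_payments V k)"
proof
  fix s r assume "(s, r) \<in># homogeneous_payments V k"
  then have "count (homogeneous_payments V k) (s, r) \<noteq> 0" by (simp only: count_eq_zero_iff not_not)
  then show "s \<in> V \<and> r \<in> V \<and> s \<noteq> r"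
    using count_homogeneous_payments[OF assms(1), of k s r] by (auto split: if_splits)
qed (use assms in auto)

definition clique_profile :: "nat \<Rightarrow> nat \<Rightarrow> nat set" where
  "clique_profile N i = {i + 1..N}"

end

(*
When node u deviates, all other nodes stay pairwise adjacent, so every payment between two of
them takes its direct channel and u earns no forwarding revenue. Node u can therefore only save
on channels, but each of its N - u channels that it omits leaves k payments that cost at least
min f0 FB >= FB / k each, which together are at least the saved fee FB.
*)
theory Submission
  imports Defs
begin

lemma sum_mset_filter_repeat_mset_set:
  fixes g :: "'b \<Rightarrow> real"
  assumes "finite A"
  shows "(\<Sum>x\<in>#filter_mset P (repeat_mset k (mset_set A)). g x) = real k * (\<Sum>x\<in>{x\<in>A. P x}. g x)"
  using assms
  by (induction k) (simp_all add: filter_mset_mset_set sum_unfold_sum_mset algebra_simps)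

text \<open>Turns the fees in \<open>cost\<close> into a sum over receivers, which can then be
  compared one by one.\<close>

lemma sum_mset_homogeneous_payments_from:
  fixes g :: "'a \<times> 'a \<Rightarrow> real"
  assumes "finite V" "u \<in> V"
  shows "(\<Sum>x\<in>#filter_mset (\<lambda>t. fst t = u) (homogeneous_payments V k). g x) =
    real k * (\<Sum>r\<in>V - {u}. g (u, r))"
proof -
  let ?A = "{(s, r). s \<in> V \<and> r \<in> V \<and> s \<noteq> r}"
  have "finite ?A"
    by (rule finite_subset[of _ "V \<times> V"]) (use assms in auto)
  moreover have "{x\<in>?A. fst x = u} = Pair u ` (V - {u})"
    using assms by auto
  ultimately show ?thesis
    unfolding homogeneous_payments_def
    by (simp add: sum_mset_filter_repeat_mset_set sum.reindex inj_on_def)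
qed

context channel_game
begin

text \<open>Distinct endpoints rule out the empty route, whose \<open>route_cost\<close> would be
  \<open>- f\<^sub>0\<close>.\<close>

lemma length_route_ge_1:
  assumes "p \<in> routes \<mu> s r" "s \<noteq> r"
  shows "length p \<ge> 1"
  using assms by (cases p)
    (auto simp: routes_def pre_digraph.apath_def pre_digraph.awalk_def pre_digraph.cas.simps)

lemma length_route_1:
  assumes "p \<in> routes \<mu> s r" "length p = 1"
  shows "p = [(s, r)] \<and> (s, r) \<in> parcs (channel_graph \<mu>)"
  using assms by (cases p)
    (auto simp: routes_def pre_digraph.apath_def pre_digraph.awalk_def pre_digraph.cas.simps)

lemma direct_route:
  assumes "(s, r) \<in> parcs (channel_graph \<mu>)" "s \<noteq> r"
  shows "[(s, r)] \<in> routes \<mu> s r"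
  using assms
  by (auto simp: routes_def pre_digraph.apath_def pre_digraph.awalk_def pre_digraph.cas.simps
      pre_digraph.awalk_verts.simps channel_graph_def)

text \<open>The direct route costs 0, and since \<open>f\<^sub>0 > 0\<close> any longer route costs
  strictly more, so no tie remains.\<close>

lemma cheapest_routes_adjacent:
  assumes "(s, r) \<in> parcs (channel_graph \<mu>)" "s \<noteq> r" "f\<^sub>0 > 0"
  shows "cheapest_routes \<mu> s r = {[(s, r)]}"
proof -
  have cost: "route_cost [(s, r)] = 0"
    by (simp add: route_cost_def)
  have nonneg: "route_cost p \<ge> 0" if "p \<in> routes \<mu> s r" for p
    using length_route_ge_1[OF that assms(2)] assms(3) by (simp add: route_cost_def)
  have unique: "p = [(s, r)]" if "p \<in> cheapest_routes \<mu> s r" for p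
  proof -
    have p: "p \<in> routes \<mu> s r" "route_cost p \<le> 0"
      using that direct_route[OF assms(1,2)] cost by (force simp: cheapest_routes_def)+
    then have "length p = 1"
      using length_route_ge_1[OF p(1) assms(2)] assms(3)
      by (auto simp: route_cost_def mult_le_0_iff)
    then show ?thesis using length_route_1[OF p(1)] by blast
  qed
  have "[(s, r)] \<in> cheapest_routes \<mu> s r"
    using direct_route[OF assms(1,2)] nonneg by (simp add: cheapest_routes_def cost)
  then show ?thesis using unique by blast
qed

lemma sender_fee_adjacent:
  assumes "(s, r) \<in> parcs (channel_graph \<mu>)" "s \<noteq> r" "f\<^sub>0 > 0"
  shows "sender_fee \<mu> s r = 0"
  using F\<^sub>B_pos
  by (simp add: sender_fee_def off_chain_def route_pmf_def cheapest_routes_adjacent[OF assms]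
      pmf_of_set_singleton route_cost_def)

lemma forwarding_revenue_adjacent:
  assumes "(s, r) \<in> parcs (channel_graph \<mu>)" "s \<noteq> r" "f\<^sub>0 > 0"
  shows "forwarding_revenue \<mu> u s r = 0"
  by (auto simp: forwarding_revenue_def route_pmf_def cheapest_routes_adjacent[OF assms]
      pmf_of_set_singleton intermediates_def)

lemma forwarding_revenue_endpoint:
  assumes "u = s \<or> u = r"
  shows "forwarding_revenue \<mu> u s r = 0"
  using assms by (auto simp: forwarding_revenue_def intermediates_def)

text \<open>An expectation inherits every lower bound that holds on its support;
  \<open>c \<le> F\<^sub>B\<close> covers the on-chain case.\<close>

lemma sender_fee_ge:
  assumes "valid_profile \<mu>" "c \<le> F\<^sub>B" "\<And>p. p \<in> routes \<mu> s r \<Longrightarrow> c \<le> route_cost p"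
  shows "c \<le> sender_fee \<mu> s r"
proof (cases "off_chain \<mu> s r")
  case True
  \<comment> \<open>\<open>pmf_of_set\<close> has the intended support only for a finite nonempty
    set.\<close>
  then have ne: "cheapest_routes \<mu> s r \<noteq> {}"
    by (auto simp: off_chain_def)
  have set: "set_pmf (route_pmf \<mu> s r) = cheapest_routes \<mu> s r"
    unfolding route_pmf_def by (rule set_pmf_of_set[OF ne finite_cheapest_routes[OF assms(1)]])
  have "c \<le> measure_pmf.expectation (route_pmf \<mu> s r) route_cost"
    by (rule measure_pmf.integral_ge_const)
      (use assms finite_cheapest_routes[OF assms(1)] set in
        \<open>auto simp: AE_measure_pmf_iff cheapest_routes_def intro!: integrable_measure_pmf_finite\<close>)
  then show ?thesis using True by (simp add: sender_fee_def)
qed (use assms in \<open>simp add: sender_fee_def\<close>)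

lemma sender_fee_nonneg:
  assumes "valid_profile \<mu>" "s \<noteq> r"
  shows "0 \<le> sender_fee \<mu> s r"
  using sender_fee_ge[OF assms(1)] length_route_ge_1[OF _ assms(2)] F\<^sub>B_pos f\<^sub>0_nonneg
  by (force simp: route_cost_def)

text \<open>Every route has at least two edges and so pays \<open>f\<^sub>0\<close> at least once;
  the minimum accounts for on-chain execution.\<close>

lemma sender_fee_nonadjacent:
  assumes "valid_profile \<mu>" "s \<noteq> r" "(s, r) \<notin> parcs (channel_graph \<mu>)"
  shows "min f\<^sub>0 F\<^sub>B \<le> sender_fee \<mu> s r"
proof (rule sender_fee_ge[OF assms(1)])
  fix p assume p: "p \<in> routes \<mu> s r"
  have "length p \<ge> 2"
    using length_route_ge_1[OF p assms(2)] length_route_1[OF p] assms(3) by force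
  then have "1 * f\<^sub>0 \<le> route_cost p"
    unfolding route_cost_def using f\<^sub>0_nonneg by (intro mult_right_mono) auto
  then show "min f\<^sub>0 F\<^sub>B \<le> route_cost p" by simp
qed simp

text \<open>A payment between two other nodes uses their direct channel, and one that starts or ends
  at \<open>u\<close> has \<open>u\<close> as no intermediate, so \<open>u\<close> forwards
  nothing.\<close>

lemma cost_others_adjacent:
  assumes "f\<^sub>0 > 0"
    and "\<And>s r. s \<in> nodes - {u} \<Longrightarrow> r \<in> nodes - {u} \<Longrightarrow> s \<noteq> r \<Longrightarrow> (s, r) \<in> parcs (channel_graph \<mu>)"
  shows "cost \<mu> u = real (card (\<mu> u)) * F\<^sub>B
    + (\<Sum>(s, r)\<in>#filter_mset (\<lambda>t. fst t = u) payments. sender_fee \<mu> s r)"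
proof -
  have "forwarding_revenue \<mu> u s r = 0" if "(s, r) \<in># payments" for s r
    using payments_wf[OF that] assms forwarding_revenue_adjacent forwarding_revenue_endpoint
    by (metis Diff_iff singletonD)
  then have "(\<Sum>(s, r)\<in>#payments. forwarding_revenue \<mu> u s r) = 0"
    by (intro sum_mset.neutral) auto
  then show ?thesis by (simp add: cost_def)
qed

end

theorem mainTheorem5:
  fixes N k :: nat and F\<^sub>B f\<^sub>0 :: real
  assumes "N > 3"
    and "F\<^sub>B > 0"
    and "f\<^sub>0 \<ge> 0"
    and "k \<ge> 1"
    and "f\<^sub>0 > F\<^sub>B / real k"
  shows "channel_game.nash_equilibrium {1..N} F\<^sub>B f\<^sub>0 (homogeneous_payments {1..N} k)
           (clique_profile N)"
proof -
  define V where "V = {1..N}"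
  let ?\<mu> = "clique_profile N"
  interpret channel_game V F\<^sub>B f\<^sub>0 "homogeneous_payments V k"
    using assms by (intro channel_game_homogeneous) (auto simp: V_def)
  have f0: "f\<^sub>0 > 0"
    using assms by (smt (verit) divide_nonneg_nonneg of_nat_0_le_iff)
  have opens: "r \<in> ?\<mu> s \<longleftrightarrow> s < r" if "r \<in> V" for r s
    using that by (auto simp: clique_profile_def V_def)
  \<comment> \<open>The smaller of \<open>s\<close> and \<open>r\<close> opens the channel, and its
    strategy is untouched by the change at \<open>u\<close>.\<close>
  have arc: "(s, r) \<in> parcs (channel_graph (?\<mu>(u := S)))"
    if "s \<in> V - {u}" "r \<in> V - {u}" "s \<noteq> r" for u S s r
    using that by (auto simp: channel_graph_def opens)
  have cost: "cost (?\<mu>(u := S)) u = real (card S) * F\<^sub>B +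
      real k * (\<Sum>r\<in>V - {u}. sender_fee (?\<mu>(u := S)) u r)" if "u \<in> V" for u S
    using that arc by (subst cost_others_adjacent[OF f0])
      (auto simp: sum_mset_homogeneous_payments_from finite_nodes)
  have valid: "valid_profile ?\<mu>"
    unfolding valid_profile_def strategies_def by (auto simp: clique_profile_def V_def)
  have "cost ?\<mu> u \<le> cost (?\<mu>(u := S)) u" if u: "u \<in> V" and S: "S \<in> strategies u" for u S
  proof -
    \<comment> \<open>\<open>?R\<close> collects the receivers without a direct channel after the
      deviation: nodes below \<open>u\<close> still open theirs to \<open>u\<close>, so only larger
      nodes outside \<open>S\<close> are affected.\<close>
    let ?\<nu> = "?\<mu>(u := S)" and ?R = "{u+1..N} - S"
    have "sender_fee ?\<mu> u r = 0" if "r \<in> V - {u}" for r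
      by (rule sender_fee_adjacent)
        (use that u f0 in \<open>auto simp: channel_graph_def opens\<close>)
    \<comment> \<open>Choosing \<open>S\<close> as the clique strategy of \<open>u\<close> leaves
      the profile unchanged, so the formula for deviations applies to the clique as well.\<close>
    then have "cost ?\<mu> u = real (card (?\<mu> u)) * F\<^sub>B"
      using cost[OF u, of "?\<mu> u"] by simp
    then have clique: "cost ?\<mu> u = real (N - u) * F\<^sub>B"
      by (simp add: clique_profile_def)
    have valid': "valid_profile ?\<nu>"
      using valid S by (auto simp: valid_profile_def)
    have finS: "finite S"
      using S finite_nodes by (auto simp: strategies_def intro: finite_subset)
    have fee: "F\<^sub>B / real k \<le> sender_fee ?\<nu> u r" if "r \<in> ?R" for r
    proof -
      have "r \<in> V"
        using that by (simp add: V_def)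
      then have "(u, r) \<notin> parcs (channel_graph ?\<nu>)"
        using that u by (auto simp: channel_graph_def opens)
      then have "min f\<^sub>0 F\<^sub>B \<le> sender_fee ?\<nu> u r"
        using that by (intro sender_fee_nonadjacent[OF valid']) auto
      \<comment> \<open>Together with the assumed bound on \<open>f\<^sub>0\<close>, this puts
        \<open>F\<^sub>B / real k\<close> below both terms of the minimum.\<close>
      moreover have "F\<^sub>B / real k \<le> F\<^sub>B"
        using assms by (simp add: divide_le_eq)
      ultimately show ?thesis using assms(5) by linarith
    qed
    have "real (card ?R) * (F\<^sub>B / real k) \<le> (\<Sum>r\<in>?R. sender_fee ?\<nu> u r)"
      using fee by (rule sum_bounded_below)
    also have "\<dots> \<le> (\<Sum>r\<in>V - {u}. sender_fee ?\<nu> u r)"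
    proof (rule sum_mono2)
      show "?R \<subseteq> V - {u}" by (auto simp: V_def)
    qed (use finite_nodes in \<open>auto intro!: sender_fee_nonneg[OF valid']\<close>)
    finally have "real k * (real (card ?R) * (F\<^sub>B / real k)) \<le>
        real k * (\<Sum>r\<in>V - {u}. sender_fee ?\<nu> u r)"
      by (intro mult_left_mono) auto
    \<comment> \<open>The \<open>k\<close> payments to each node of \<open>?R\<close> cancel the
      divisor \<open>k\<close>, so each omitted channel costs a full
      \<open>F\<^sub>B\<close>.\<close>
    then have dev: "real (card S) * F\<^sub>B + real (card ?R) * F\<^sub>B \<le> cost ?\<nu> u"
      using cost[OF u, of S] assms(4) by simp
    \<comment> \<open>Only an inequality, since \<open>S\<close> may also contain nodes below
      \<open>u\<close>; such channels only add to the cost.\<close>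
    have "N - u \<le> card S + card ?R"
      using diff_card_le_card_Diff[OF finS, of "{u+1..N}"] by simp
    then have "real (N - u) * F\<^sub>B \<le> real (card S + card ?R) * F\<^sub>B"
      using assms(2) by (intro mult_right_mono) linarith+
    then show ?thesis using clique dev by (simp add: distrib_right)
  qed
  then show ?thesis
    using valid unfolding V_def[symmetric] by (auto simp: nash_equilibrium_def not_less)
qed

end
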